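(* Let $G$ be a directed graph without multiedges, $s,t$ nodes of $G$, and $B$ its $s$-$t$ bridge sequence. A substring $L=(e_1,\dots,e_k)$ of $B$ is safe under the $s$-$t$ walks model if and only if $L$ has no walk breaker, i.e. there is no index $1\le i<k$ together with a non-empty path from $\mathrm{head}(e_i)$ to $\mathrm{tail}(e_{i+1})$ that uses neither $e_1$ nor $e_k$.
   Context: An $s$-$t$ bridge is an edge whose removal leaves no $s$-$t$ path; all $s$-$t$ bridges appear on every $s$-$t$ path in the same order, and $B$ is the sequence of $s$-$t$ bridges in this order. For an edge $e=(u,v)$, $\mathrm{tail}(e)=u$, $\mathrm{head}(e)=v$. An $s$-$t$ walk may repeat nodes and edges. A sequence of edges is safe under the $s$-$t$ walks model if it is a substring (contiguous) of the edge sequence of every $s$-$t$ walk of $G$. *)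

theory Defs
  imports "Graph_Theory.Arc_Walk" "HOL-Library.Sublist"
begin

text \<open>
  A path repeats no node, except that its first and last node may coincide. The exception matters:
  when the head of one bridge is the tail of the next, the non-empty paths between these nodes
  are the cycles through that node. The library's \<open>apath\<close> excludes them.
\<close>
definition is_path :: "('a, 'b) pre_digraph \<Rightarrow> 'a \<Rightarrow> 'b list \<Rightarrow> 'a \<Rightarrow> bool" where
  "is_path G u p v \<longleftrightarrow> pre_digraph.awalk G u p v \<and>
     distinct (butlast (pre_digraph.awalk_verts G u p)) \<and>
     distinct (tl (pre_digraph.awalk_verts G u p))"

definition st_bridge :: "('a, 'b) pre_digraph \<Rightarrow> 'a \<Rightarrow> 'a \<Rightarrow> 'b \<Rightarrow> bool" where
  "st_bridge G s t e \<longleftrightarrow> e \<in> arcs G \<and> \<not> (\<exists>p. is_path (pre_digraph.del_arc G e) s p t)"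

text \<open>
  The order of the bridges is the one in which they occur on the \<open>s\<close>-\<open>t\<close> paths, so there is a bridge
  sequence only if there is an \<open>s\<close>-\<open>t\<close> path. (\<open>subseq\<close> is the not necessarily contiguous
  subsequence relation, \<open>sublist\<close> the contiguous one.)
\<close>
definition st_bridge_seq :: "('a, 'b) pre_digraph \<Rightarrow> 'a \<Rightarrow> 'a \<Rightarrow> 'b list \<Rightarrow> bool" where
  "st_bridge_seq G s t B \<longleftrightarrow>
     distinct B \<and> set B = {e. st_bridge G s t e} \<and>
     (\<exists>p. is_path G s p t) \<and> (\<forall>p. is_path G s p t \<longrightarrow> subseq B p)"

definition safe_st_walks :: "('a, 'b) pre_digraph \<Rightarrow> 'a \<Rightarrow> 'a \<Rightarrow> 'b list \<Rightarrow> bool" where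
  "safe_st_walks G s t L \<longleftrightarrow> (\<forall>p. pre_digraph.awalk G s p t \<longrightarrow> sublist L p)"

definition walk_breaker :: "('a, 'b) pre_digraph \<Rightarrow> 'b list \<Rightarrow> nat \<Rightarrow> 'b list \<Rightarrow> bool" where
  "walk_breaker G L i p \<longleftrightarrow> Suc i < length L \<and> p \<noteq> [] \<and>
     is_path G (head G (L ! i)) p (tail G (L ! Suc i)) \<and>
     hd L \<notin> set p \<and> last L \<notin> set p"

end

theory Submission
  imports Defs
begin

text \<open>
  Every \<open>s\<close>-\<open>t\<close> walk contains every bridge. Fix an \<open>s\<close>-\<open>t\<close> path \<open>P\<close>; all its arcs are distinct.

  A walk breaker \<open>p\<close> at \<open>i\<close> can be spliced into \<open>P\<close> between \<open>e\<^sub>i\<close> and \<open>e\<^sub>i\<^sub>+\<^sub>1\<close>. In the resulting walk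
  \<open>e\<^sub>1\<close> and \<open>e\<^sub>k\<close> still occur only once, and the segment between them is longer than \<open>L\<close>.

  Conversely, in any \<open>s\<close>-\<open>t\<close> walk take the first \<open>e\<^sub>k\<close> and the last \<open>e\<^sub>1\<close> before it. The segment \<open>Q\<close>
  between them avoids \<open>e\<^sub>1\<close> and \<open>e\<^sub>k\<close>. Completing what remains of \<open>Q\<close> after \<open>e\<^sub>i\<close> to an \<open>s\<close>-\<open>t\<close> walk
  by pieces of \<open>P\<close> shows that \<open>e\<^sub>i\<^sub>+\<^sub>1\<close> occurs there, and it comes immediately, since otherwise a
  walk breaker could be extracted.
\<close>

lemma set_mono_subseq: "subseq xs ys \<Longrightarrow> set xs \<subseteq> set ys"
  by (auto dest: list_emb_set)

lemma subseq_split_at_distinct: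
  assumes "subseq (xs @ x # ys) (ps @ x # qs)" "distinct (ps @ x # qs)"
  shows "subseq xs ps" "subseq ys qs"
proof -
  have "subseq xs ps \<and> subseq ys qs"
    using assms
  proof (induction ps arbitrary: xs)
    case Nil
    show ?case
    proof (cases xs)
      case (Cons c cs)
      then have "subseq (cs @ x # ys) qs"
        using Nil.prems by (auto split: if_splits dest: subseq_Cons')
      then have "x \<in> set qs"
        by (auto dest: set_mono_subseq)
      then show ?thesis using Nil.prems by simp
    qed (use Nil in auto)
  next
    case (Cons p ps)
    show ?case
    proof (cases xs)
      case Nil
      then show ?thesis using Cons.IH[of "[]"] Cons.prems by auto
    next
      case (Cons c cs)
      then show ?thesis
        using Cons.IH[of cs] Cons.IH[of xs] Cons.prems by (auto split: if_splits)
    qed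
  qed
  then show "subseq xs ps" "subseq ys qs" by auto
qed

lemma sublist_splice_imp_Nil:
  assumes dist: "distinct (ps @ e # f # qs)"
    and sub: "subseq xs ps" "subseq ys qs"
    and avoid: "hd (xs @ [e]) \<notin> set p" "last (f # ys) \<notin> set p"
    and sl: "sublist (xs @ e # f # ys) (ps @ e # p @ f # qs)"
  shows "p = []"
proof -
  obtain a xs' where a: "xs @ [e] = a # xs'" by (cases "xs @ [e]") auto
  obtain z ys' where z: "f # ys = ys' @ [z]" by (cases "f # ys" rule: rev_cases) auto
  have "subseq (xs @ [e]) (ps @ [e])" using sub by simp
  then obtain u u' where u: "ps @ [e] = u @ a # u'" "subseq xs' u'"
    unfolding a by (auto dest: list_emb_ConsD)
  have "subseq (f # ys) (f # qs)" using sub by simp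
  then obtain v v' where v: "f # qs = v' @ z # v" "subseq ys' v'"
    unfolding z
    by (auto simp: append.assoc dest!: list_emb_appendD list_emb_ConsD)
      (metis append.assoc subseq_rev_drop_many)
  obtain A C where "ps @ e # p @ f # qs = A @ (xs @ e # f # ys) @ C"
    using sl by (auto simp: sublist_def)
  then have "(ps @ [e]) @ p @ (f # qs) = A @ ((xs @ [e]) @ (f # ys)) @ C" by simp
  then have eq: "u @ a # (u' @ p @ v' @ z # v) = A @ a # (xs' @ ys' @ z # C)"
    unfolding a z u v by simp
  have dist': "distinct ((u @ a # u') @ (v' @ z # v))"
    using dist unfolding u(1)[symmetric] v(1)[symmetric] by simp
  have "a \<notin> set p" "z \<notin> set p" using avoid a z by auto
  with dist' have "u' @ p @ v' @ z # v = xs' @ ys' @ z # C"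
    using eq by (subst (asm) append_Cons_eq_iff) auto
  then have "(u' @ p @ v') @ z # v = (xs' @ ys') @ z # C" by simp
  then have "u' @ p @ v' = xs' @ ys'"
    using dist' \<open>z \<notin> set p\<close> by (subst (asm) append_Cons_eq_iff) auto
  then have "length u' + length p + length v' = length xs' + length ys'"
    by (auto dest: arg_cong[of _ _ length])
  moreover have "length xs' \<le> length u'" "length ys' \<le> length v'"
    using u(2) v(2) by (auto dest: list_emb_length)
  ultimately have "length p = 0" by linarith
  then show ?thesis by simp
qed

context wf_digraph
begin

lemma awalk_append_Cons_iff:
  "awalk u (p @ e # q) v \<longleftrightarrow> e \<in> arcs G \<and> awalk u p (tail G e) \<and> awalk (head G e) q v"
  by (auto simp: awalk_Cons_iff)

lemma is_path_if_apath: "apath u p v \<Longrightarrow> is_path G u p v"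
  unfolding apath_def is_path_def by (auto simp: distinct_butlast distinct_tl)

lemma distinct_if_is_path: "is_path G u p v \<Longrightarrow> distinct p"
  unfolding is_path_def by (auto intro: distinct_tl_verts_imp_distinct)

lemma nonempty_awalk_contains_is_path:
  assumes "awalk u p v" "p \<noteq> []"
  obtains q where "is_path G u q v" "q \<noteq> []" "set q \<subseteq> set p"
proof (cases "u = v")
  case False
  let ?q = "awalk_to_apath p"
  have q: "apath u ?q v" using assms by (intro apath_awalk_to_apath)
  moreover have "?q \<noteq> []" using q False by (auto simp: apath_Nil_iff)
  ultimately show ?thesis
    using that is_path_if_apath awalk_to_apath_subset[OF assms(1)] by blast
next
  case True
  obtain a r where p: "p = a # r" using assms(2) by (cases p) auto
  then have a: "a \<in> arcs G" "tail G a = u" and r: "awalk (head G a) r v"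
    using assms(1) by (auto simp: awalk_Cons_iff)
  let ?q = "awalk_to_apath r"
  let ?vs = "awalk_verts (head G a) ?q"
  have q: "awalk (head G a) ?q v" "distinct ?vs"
    using apath_awalk_to_apath[OF r] by (auto simp: apath_def)
  have vs: "?vs = butlast ?vs @ [v]"
    using append_butlast_last_id[OF awalk_verts_non_Nil, of "head G a" ?q] q(1) by (auto elim: awalkE)
  have "distinct (butlast ?vs @ [v])" using q(2) vs by simp
  then have "is_path G u (a # ?q) v"
    using a q True by (auto simp: is_path_def awalk_Cons_iff)
  then show ?thesis
    using that[of "a # ?q"] awalk_to_apath_subset[OF r] p by auto
qed

lemma st_bridge_in_awalk:
  assumes "st_bridge G s t e" "awalk s p t"
  shows "e \<in> set p"
proof (rule ccontr)
  assume "e \<notin> set p"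
  interpret D: wf_digraph "del_arc e" by (rule wf_digraph_del_arc)
  have "D.cas u p v = cas u p v" for u v
    by (induction p arbitrary: u) auto
  then have "D.awalk s p t"
    using assms(2) \<open>e \<notin> set p\<close> by (auto simp: D.awalk_def awalk_def)
  then have "is_path (del_arc e) s (D.awalk_to_apath p) t"
    by (intro D.is_path_if_apath D.apath_awalk_to_apath)
  then show False using assms(1) by (auto simp: st_bridge_def)
qed

lemma walk_breaker_imp_not_safe:
  assumes P: "is_path G s P t" and LP: "subseq L P"
    and wb: "walk_breaker G L i p"
  shows "\<not> safe_st_walks G s t L"
proof
  assume safe: "safe_st_walks G s t L"
  define e f X Y where "e = L ! i" "f = L ! Suc i" "X = take i L" "Y = drop (Suc (Suc i)) L"
  have i: "Suc i < length L" using wb by (simp add: walk_breaker_def)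
  have L: "L = X @ e # f # Y"
    unfolding e_f_X_Y_def using i by (metis Cons_nth_drop_Suc Suc_lessD append_take_drop_id)
  have distP: "distinct P" using P by (rule distinct_if_is_path)
  have "e \<in> set P" using LP L by (auto dest: set_mono_subseq)
  then obtain P1 P' where P1: "P = P1 @ e # P'" by (auto dest: split_list)
  have X: "subseq X P1" and fY: "subseq (f # Y) P'"
    using subseq_split_at_distinct[of X e "f # Y" P1 P'] LP distP P1 L by auto
  obtain P2 P3 where P3: "P' = P2 @ f # P3" and Y: "subseq Y P3"
    using fY by (auto dest: list_emb_ConsD)
  have "awalk s P t" using P by (simp add: is_path_def)
  then have "awalk s P1 (tail G e)" "e \<in> arcs G" "f \<in> arcs G" "awalk (head G f) P3 t"
    unfolding P1 P3 by (auto simp only: awalk_append_Cons_iff)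
  moreover have "awalk (head G e) p (tail G f)"
    using wb unfolding walk_breaker_def is_path_def e_f_X_Y_def by auto
  ultimately have "awalk s (P1 @ e # p @ f # P3) t"
    by (simp only: awalk_append_Cons_iff)
  then have sl: "sublist (X @ e # f # Y) (P1 @ e # p @ f # P3)"
    using safe L by (auto simp: safe_st_walks_def)
  have "hd L = hd (X @ [e])" "last L = last (f # Y)" using L by (auto simp: hd_append)
  then have "p = []"
    using sublist_splice_imp_Nil[OF _ X Y _ _ sl] distP P1 P3 wb
    by (auto simp: walk_breaker_def)
  then show False using wb by (simp add: walk_breaker_def)
qed

lemma no_walk_breaker_segment:
  assumes P: "is_path G s P t" and LP: "subseq L P"
    and bridges: "\<And>e. e \<in> set L \<Longrightarrow> st_bridge G s t e"
    and no_wb: "\<nexists>i p. walk_breaker G L i p"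
    and "L = X @ e # Y" "Y \<noteq> []"
    and "awalk (head G e) Q (tail G (last L))"
    and "hd L \<notin> set Q" "last L \<notin> set Q"
  shows "Q @ [last L] = Y"
  using assms(5-)
proof (induction Y arbitrary: X e Q)
  case (Cons f Y)
  define z where "z = last L"
  have adjacent: "R = []" if "awalk (head G e) R (tail G f)" "set R \<subseteq> set Q" for R
  proof (rule ccontr)
    assume "R \<noteq> []"
    with that obtain q where "is_path G (head G e) q (tail G f)" "q \<noteq> []" "set q \<subseteq> set R"
      using nonempty_awalk_contains_is_path by metis
    then have "walk_breaker G L (length X) q"
      using that(2) Cons.prems unfolding walk_breaker_def by (auto simp: nth_append)
    then show False using no_wb by blast
  qed
  show ?case
  proof (cases "Y = []")
    case True
    then have "last L = f" using Cons.prems by simp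
    then show ?thesis using adjacent[of Q] Cons.prems True by simp
  next
    case False
    then obtain Y' where Y': "Y = Y' @ [z]"
      using Cons.prems(1) by (cases Y rule: rev_cases) (auto simp: z_def)
    have L: "L = X @ e # f # Y' @ [z]" using Cons.prems(1) Y' by simp
    have distP: "distinct P" using P by (rule distinct_if_is_path)
    have walkP: "awalk s P t" using P by (simp add: is_path_def)
    have "e \<in> set P" using LP Cons.prems(1) by (auto dest: set_mono_subseq)
    then obtain P1 P2 where P1: "P = P1 @ e # P2" by (auto dest: split_list)
    have "z \<in> set P" using LP L by (auto dest: set_mono_subseq)
    then obtain P3 P4 where P3: "P = P3 @ z # P4" by (auto dest: split_list)
    have "subseq (f # Y) P2"
      using subseq_split_at_distinct(2)[of X e "f # Y" P1 P2] LP distP P1 Cons.prems(1) by auto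
    then have "f \<in> set P2" by (auto dest: set_mono_subseq)
    then have "f \<notin> set P1" "f \<noteq> e" using distP P1 by auto
    have "subseq (X @ e # f # Y') P3"
      using subseq_split_at_distinct(1)[of "X @ e # f # Y'" z "[]" P3 P4] LP distP P3 L by auto
    then have "f \<in> set P3" by (auto dest: set_mono_subseq)
    then have "f \<notin> set P4" "f \<noteq> z" using distP P3 by auto
    have "e \<in> arcs G" "awalk s P1 (tail G e)"
      using walkP unfolding P1 by (auto simp only: awalk_append_Cons_iff)
    moreover have "z \<in> arcs G" "awalk (head G z) P4 t"
      using walkP unfolding P3 by (auto simp only: awalk_append_Cons_iff)
    ultimately have "awalk s (P1 @ e # Q @ z # P4) t"
      using Cons.prems(3) by (simp only: awalk_append_Cons_iff z_def)
    then have "f \<in> set (P1 @ e # Q @ z # P4)"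
      using bridges[of f] Cons.prems(1) by (intro st_bridge_in_awalk) auto
    then have "f \<in> set Q"
      using \<open>f \<notin> set P1\<close> \<open>f \<noteq> e\<close> \<open>f \<notin> set P4\<close> \<open>f \<noteq> z\<close> by auto
    then obtain R Q' where Q: "Q = R @ f # Q'" by (auto dest: split_list)
    have R: "awalk (head G e) R (tail G f)" and Q': "awalk (head G f) Q' (tail G z)"
      using Cons.prems(3) unfolding Q z_def by (auto simp only: awalk_append_Cons_iff)
    have "R = []" using adjacent[OF R] Q by auto
    moreover have "Q' @ [z] = Y"
      using Cons.IH[of "X @ [e]" f Q'] Cons.prems Q Q' False by (auto simp: z_def)
    ultimately show ?thesis using Q by (simp add: z_def)
  qed
qed simp

lemma no_walk_breaker_imp_safe:
  assumes P: "is_path G s P t" and LP: "subseq L P"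
    and bridges: "\<And>e. e \<in> set L \<Longrightarrow> st_bridge G s t e"
    and no_wb: "\<nexists>i p. walk_breaker G L i p"
  shows "safe_st_walks G s t L"
  unfolding safe_st_walks_def
proof (intro allI impI)
  fix W assume W: "awalk s W t"
  consider "L = []" | a where "L = [a]" | a b M where "L = a # b # M"
    by (metis list.exhaust)
  then show "sublist L W"
  proof cases
    case (2 a)
    then have "a \<in> set W" using st_bridge_in_awalk[OF bridges W] by simp
    then show ?thesis using 2 by (auto simp: sublist_def dest: split_list)
  next
    case (3 a b M)
    define z where "z = last L"
    have z: "z \<in> set L" and aL: "a \<in> set L" using 3 by (auto simp: z_def)
    obtain M' where M': "L = a # M' @ [z]"
      using 3 by (cases "b # M" rule: rev_cases) (auto simp: z_def)
    have distP: "distinct P" using P by (rule distinct_if_is_path)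
    have "z \<in> set W" using st_bridge_in_awalk[OF bridges[OF z] W] .
    then obtain W1 W2 where W1: "W = W1 @ z # W2" "z \<notin> set W1" by (metis split_list_first)
    have "z \<in> set P" using LP z by (auto dest: set_mono_subseq)
    then obtain P1 P2 where P1: "P = P1 @ z # P2" by (auto dest: split_list)
    have "subseq (a # M') P1"
      using subseq_split_at_distinct(1)[of "a # M'" z "[]" P1 P2] LP distP P1 M' by simp
    then have "a \<in> set P1" by (auto dest: set_mono_subseq)
    then have a: "a \<notin> set P2" "a \<noteq> z" using distP P1 by auto
    have "awalk (head G z) P2 t"
      using P unfolding is_path_def P1 by (simp only: awalk_append_Cons_iff)
    moreover have W1': "z \<in> arcs G" "awalk s W1 (tail G z)"
      using W unfolding W1(1) by (auto simp only: awalk_append_Cons_iff)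
    ultimately have "awalk s (W1 @ z # P2) t"
      by (simp only: awalk_append_Cons_iff)
    then have "a \<in> set (W1 @ z # P2)"
      using bridges[OF aL] by (intro st_bridge_in_awalk)
    then have "a \<in> set W1" using a by auto
    then obtain U Q where U: "W1 = U @ a # Q" "a \<notin> set Q" by (metis split_list_last)
    have "awalk (head G a) Q (tail G z)"
      using W1'(2) unfolding U by (simp only: awalk_append_Cons_iff)
    then have "Q @ [z] = b # M"
      unfolding z_def using U W1 3
      by (intro no_walk_breaker_segment[OF P LP bridges no_wb, of "[]" a]) (auto simp: z_def)
    then have "W = U @ L @ W2" using W1(1) U(1) 3 by (metis append.assoc append_Cons append_Nil)
    then show ?thesis by simp
  qed simp
qed

end

theorem theorem12:
  fixes G :: "('a, 'b) pre_digraph" and s t :: 'a and B L :: "'b list"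
  assumes "nomulti_digraph G"
    and "s \<in> verts G" and "t \<in> verts G"
    and "st_bridge_seq G s t B"
    and "sublist L B"
  shows "safe_st_walks G s t L \<longleftrightarrow> \<not> (\<exists>i p. walk_breaker G L i p)"
proof -
  interpret nomulti_digraph G by fact
  obtain P where P: "is_path G s P t" and "subseq B P"
    using assms(4) by (auto simp: st_bridge_seq_def)
  then have LP: "subseq L P"
    using assms(5) subseq_order.order_trans by blast
  have bridges: "st_bridge G s t e" if "e \<in> set L" for e
    using that assms(4,5) set_mono_sublist by (fastforce simp: st_bridge_seq_def)
  show ?thesis
    using walk_breaker_imp_not_safe[OF P LP] no_walk_breaker_imp_safe[OF P LP bridges]
    by blast
qed

end
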